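(* Let $N\ge3$. The class $C_{8,4}$ of domains in $\mathbb{R}^N$ which are symmetric of order $8$ with respect to some coordinate plane $(x_k,x_l)$ and symmetric of order $4$ with respect to all other coordinate planes coincides with the class of domains in $\mathbb{R}^N$ symmetric of order $8$ (with respect to all coordinate planes), and hence any $\Omega\in C_{8,4}$ is radially symmetric.
   Context: A domain is a connected open set. For $q\in\mathbb{N}$ and $1\le i<j\le N$, $R^{2\pi/q}_{i,j}$ is the anticlockwise rotation about the origin by the angle $2\pi/q$ in the coordinate plane $(x_i,x_j)$ (all other coordinates fixed). A domain $\Omega$ is symmetric of order $q$ if there is an isometry $T$ of $\mathbb{R}^N$ such that $R^{2\pi/q}_{i,j}T(\Omega)=T(\Omega)$ for all $1\le i<j\le N$. A domain $\Omega$ belongs to $C_{8,4}$ if there are an isometry $T$ of $\mathbb{R}^N$ and indices $1\le k<l\le N$ such that $R^{2\pi/8}_{k,l}T(\Omega)=T(\Omega)$ and $R^{2\pi/4}_{i,j}T(\Omega)=T(\Omega)$ for all $1\le i<j\le N$ with $(i,j)\ne(k,l)$. A domain $\Omega$ is radially symmetric if, after an isometry of $\mathbb{R}^N$, it is invariant under every element of $SO(N)$. *)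

theory Defs
  imports "HOL-Analysis.Analysis"
begin

text \<open>
  Coordinates are indexed by a finite linearly ordered type \<open>'n\<close> with \<open>N = CARD('n)\<close> elements, which
  plays the role of \<open>{1, \<dots>, N}\<close>.
\<close>

definition is_domain :: "'a::topological_space set \<Rightarrow> bool" where
  "is_domain \<Omega> \<longleftrightarrow> open \<Omega> \<and> connected \<Omega>"

text \<open>Distance-preserving maps of \<open>\<real>\<^sup>N\<close> into itself are automatically bijective and affine.\<close>

definition is_isometry :: "('a::metric_space \<Rightarrow> 'a) \<Rightarrow> bool" where
  "is_isometry T \<longleftrightarrow> (\<forall>x y. dist (T x) (T y) = dist x y)"

definition plane_rotation :: "'n \<Rightarrow> 'n \<Rightarrow> real \<Rightarrow> real^'n \<Rightarrow> real^'n::finite" where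
  "plane_rotation i j \<theta> x =
    (\<chi> m. if m = i then cos \<theta> * x $ i - sin \<theta> * x $ j
          else if m = j then sin \<theta> * x $ i + cos \<theta> * x $ j
          else x $ m)"

definition symmetric_domains :: "nat \<Rightarrow> (real^'n::{finite,linorder}) set set" where
  "symmetric_domains q =
    {\<Omega>. is_domain \<Omega> \<and>
      (\<exists>T. is_isometry T \<and>
        (\<forall>i j. i < j \<longrightarrow> plane_rotation i j (2 * pi / real q) ` (T ` \<Omega>) = T ` \<Omega>))}"

definition C_8_4 :: "(real^'n::{finite,linorder}) set set" where
  "C_8_4 =
    {\<Omega>. is_domain \<Omega> \<and>
      (\<exists>T k l. is_isometry T \<and> k < l \<and>
        plane_rotation k l (2 * pi / 8) ` (T ` \<Omega>) = T ` \<Omega> \<and>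
        (\<forall>i j. i < j \<and> (i, j) \<noteq> (k, l) \<longrightarrow>
          plane_rotation i j (2 * pi / 4) ` (T ` \<Omega>) = T ` \<Omega>))}"

text \<open>The library's \<^const>\<open>rotation_matrix\<close> is membership in \<open>SO(N)\<close>.\<close>

definition radially_symmetric :: "(real^'n::finite) set \<Rightarrow> bool" where
  "radially_symmetric \<Omega> \<longleftrightarrow>
    is_domain \<Omega> \<and>
    (\<exists>T. is_isometry T \<and> (\<forall>A :: real^'n^'n. rotation_matrix A \<longrightarrow> (*v) A ` (T ` \<Omega>) = T ` \<Omega>))"

end

(* Conjugating a rotation by pi/4 in one coordinate plane by quarter turns gives the rotations by
   pi/4 in all coordinate planes. For distinct i, j, k, composing those in the planes (j,k) and (i,j)
   gives a rotation about an axis in (i,j,k)-space through an angle incommensurable with pi, so every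
   closed invariant set C is invariant under the full one-parameter group about that axis. Take for C
   the orbit closure of a point x of the open set T(Omega) under its linear isometry group, let
   |y| = |x|, and let z maximize the inner product with y on C. Stationarity at z along all these
   one-parameter groups forces z = y, so y lies in the orbit closure of x, hence in T(Omega) by
   openness: T(Omega) is a union of spheres. *)

theory Submission
  imports Defs
begin

section \<open>An angle incommensurable with \<open>\<pi>\<close>\<close>

text \<open>The angle of the rotation of \<open>\<real>\<^sup>3\<close> composed of rotations by \<open>\<pi> / 4\<close> about two
  perpendicular axes.\<close>

definition twist_angle :: real where
  "twist_angle = arccos ((2 * sqrt 2 - 1) / 4)"

lemma sqrt2_bounds: "1 < sqrt (2::real)" "sqrt (2::real) < 3/2"
  by (rule real_less_rsqrt real_less_lsqrt; simp add: power2_eq_square)+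

lemma cos_twist_angle: "cos twist_angle = (2 * sqrt 2 - 1) / 4"
  unfolding twist_angle_def using sqrt2_bounds by (intro cos_arccos) auto

text \<open>The factor \<open>sqrt (5 - 2 * sqrt 2)\<close> is the length of the axis vector (1,
  sqrt 2 - 1, 1). Factored out, it cancels against the normalisation in
  \<open>plane_rotation_compose_spin\<close>.\<close>

lemma sin_twist_angle: "sin twist_angle = sqrt (5 - 2 * sqrt 2) * (1 + sqrt 2) / 4"
proof -
  have "sin twist_angle = sqrt (1 - ((2 * sqrt 2 - 1) / 4)\<^sup>2)"
    unfolding twist_angle_def using sqrt2_bounds by (intro sin_arccos) auto
  also have "1 - ((2 * sqrt 2 - 1) / 4)\<^sup>2 = (5 - 2 * sqrt 2) * ((1 + sqrt 2) / 4)\<^sup>2"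
    by (simp add: power2_eq_square field_simps)
  also have "sqrt \<dots> = sqrt (5 - 2 * sqrt 2) * (1 + sqrt 2) / 4"
    using sqrt2_bounds by (simp add: real_sqrt_mult)
  finally show ?thesis .
qed

text \<open>Odd numerators mean that \<open>2 cos (n \<alpha>)\<close> is never an algebraic integer for \<open>n \<ge> 1\<close>.\<close>

lemma cos_multiple_twist_angle:
  "\<exists>(a::int) (b::int) (a'::int) (b'::int). 2 ^ Suc n * cos (real n * twist_angle) = a + b * sqrt 2 \<and>
     2 ^ Suc (Suc n) * cos (real (Suc n) * twist_angle) = a' + b' * sqrt 2 \<and> odd a'"
proof (induction n)
  case 0
  show ?case
    by (rule exI[of _ 2], rule exI[of _ 0], rule exI[of _ "-1"], rule exI[of _ 2])
      (simp add: cos_twist_angle field_simps)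
next
  case (Suc n)
  let ?c = "\<lambda>m. 2 ^ Suc m * cos (real m * twist_angle)"
  obtain a b a' b' :: int where ab: "?c n = a + b * sqrt 2"
    and ab': "?c (Suc n) = a' + b' * sqrt 2" "odd a'"
    using Suc.IH by blast
  have eq: "real (Suc (Suc n)) * twist_angle = real (Suc n) * twist_angle + twist_angle"
    "real n * twist_angle = real (Suc n) * twist_angle - twist_angle"
    by (simp_all add: algebra_simps)
  have "cos (real (Suc (Suc n)) * twist_angle) + cos (real n * twist_angle)
      = 2 * cos twist_angle * cos (real (Suc n) * twist_angle)"
    unfolding eq cos_add cos_diff by simp
  then have "cos (real (Suc (Suc n)) * twist_angle)
      = 2 * cos twist_angle * cos (real (Suc n) * twist_angle) - cos (real n * twist_angle)"
    by (simp del: of_nat_Suc)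
  then have "?c (Suc (Suc n)) = (2 * sqrt 2 - 1) * ?c (Suc n) - 4 * ?c n"
    by (simp only: cos_twist_angle power_Suc) (simp add: field_simps del: of_nat_Suc)
  \<comment> \<open>In the new rational part only a' has an odd coefficient, so oddness is
    inherited.\<close>
  also have "\<dots> = of_int (4 * b' - a' - 4 * a) + of_int (2 * a' - b' - 4 * b) * sqrt 2"
    unfolding ab ab' by (simp add: algebra_simps)
  finally show ?case
    using ab' by (intro exI[of _ a'] exI[of _ b'] exI[of _ "4 * b' - a' - 4 * a"]
      exI[of _ "2 * a' - b' - 4 * b"]) simp
qed

text \<open>Otherwise some positive multiple of the angle has cosine 1. Then an even power of two
  minus an odd integer has square 2 b^2, which parity forbids.\<close>

lemma twist_angle_irrational: "twist_angle / (2 * pi) \<notin> \<rat>"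
proof
  assume "twist_angle / (2 * pi) \<in> \<rat>"
  then obtain p q :: int where q: "q > 0" and pq: "twist_angle / (2 * pi) = p / q"
    by (meson Rats_cases')
  define m where "m = nat (q - 1)"
  have m: "real (Suc m) = q" using q by (simp add: m_def)
  have "real (Suc m) * twist_angle = 2 * pi * p"
    using pq q unfolding m by (simp add: field_simps)
  then have c: "cos (real (Suc m) * twist_angle) = 1"
    by (metis cos_int_2pin)
  obtain a b :: int where "2 ^ Suc (Suc m) * (1::real) = a + b * sqrt 2" and a: "odd a"
    using cos_multiple_twist_angle[of m] unfolding c by blast
  then have "(2 ^ Suc (Suc m) - of_int a)\<^sup>2 = (of_int b * sqrt 2)\<^sup>2"
    by simp
  then have "of_int ((2 ^ Suc (Suc m) - a)\<^sup>2) = (of_int (2 * b\<^sup>2) :: real)"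
    by (simp add: power_mult_distrib)
  then have "(2 ^ Suc (Suc m) - a)\<^sup>2 = 2 * b\<^sup>2"
    by (simp only: of_int_eq_iff)
  then have "even ((2 ^ Suc (Suc m) - a)\<^sup>2)"
    by simp
  then show False using a by simp
qed

section \<open>One-parameter groups of rotations\<close>

text \<open>Rodrigues' formula for \<open>exp (s K)\<close>, valid when \<open>K\<^sup>3 = - K\<close>.\<close>

definition spin :: "('a::real_vector \<Rightarrow> 'a) \<Rightarrow> real \<Rightarrow> 'a \<Rightarrow> 'a" where
  "spin K s x = x + sin s *\<^sub>R K x + (1 - cos s) *\<^sub>R K (K x)"

lemma spin_0 [simp]: "spin K 0 x = x"
  by (simp add: spin_def)

lemma spin_add:
  assumes "linear K" and K3: "\<And>x. K (K (K x)) = - K x"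
  shows "spin K s (spin K t x) = spin K (s + t) x"
proof -
  interpret linear K by fact
  have "spin K s (spin K t x) = x
      + (sin s + sin t - sin s * (1 - cos t) - (1 - cos s) * sin t) *\<^sub>R K x
      + ((1 - cos s) + (1 - cos t) + sin s * sin t - (1 - cos s) * (1 - cos t)) *\<^sub>R K (K x)"
    by (simp add: spin_def add diff neg scale K3 algebra_simps)
  also have "\<dots> = spin K (s + t) x"
    unfolding spin_def sin_add cos_add by (simp add: algebra_simps)
  finally show ?thesis .
qed

lemma spin_multiple:
  assumes "linear K" and "\<And>x. K (K (K x)) = - K x"
  shows "(spin K t ^^ n) x = spin K (real n * t) x"
proof (induction n)
  case (Suc n)
  then show ?case
    using spin_add[OF assms, of t "real n * t" x] by (simp add: algebra_simps)
qed simp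

text \<open>The parameters u, counted in full turns, that keep z in C form a closed set. It contains
  the fractional parts of all n \<alpha> / (2 pi), which are dense in [0, 1].\<close>

lemma spin_invariant_irrational:
  fixes K :: "'a::real_normed_vector \<Rightarrow> 'a"
  assumes K: "linear K" "\<And>x. K (K (K x)) = - K x"
    and irr: "\<alpha> / (2 * pi) \<notin> \<rat>"
    and C: "closed C" and inv: "\<And>x. x \<in> C \<Longrightarrow> spin K \<alpha> x \<in> C"
    and z: "z \<in> C"
  shows "spin K s z \<in> C"
proof -
  define U where "U = (\<lambda>u. spin K (2 * pi * u) z) -` C"
  have "closed U"
    unfolding U_def spin_def by (intro closed_vimage C continuous_intros)
  have periodic: "spin K (2 * pi * frac u) z = spin K (2 * pi * u) z" for u
  proof -
    have *: "2 * pi * frac u = 2 * pi * u - 2 * pi * of_int \<lfloor>u\<rfloor>"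
      by (simp add: frac_def algebra_simps)
    show ?thesis
      unfolding spin_def * sin_diff cos_diff by simp
  qed
  have "frac (real n * (\<alpha> / (2 * pi))) \<in> U" for n
  proof -
    have "(spin K \<alpha> ^^ n) z \<in> C"
      by (induction n) (simp_all add: z inv)
    then show ?thesis
      unfolding U_def vimage_eq periodic by (simp add: spin_multiple[OF K])
  qed
  then have "{0..1} \<subseteq> U"
    using Kronecker_approx_1[OF irr] closure_minimal[OF _ \<open>closed U\<close>]
    by (metis image_subsetI)
  then have "frac (s / (2 * pi)) \<in> U"
    using frac_ge_0[of "s / (2 * pi)"] frac_lt_1[of "s / (2 * pi)"] by fastforce
  then show ?thesis
    unfolding U_def vimage_eq periodic by simp
qed

section \<open>Rotations in coordinate planes\<close>

lemma plane_rotation_add: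
  assumes "i \<noteq> j"
  shows "plane_rotation i j s (plane_rotation i j t x) = plane_rotation i j (s + t) x"
  using assms by (simp add: plane_rotation_def vec_eq_iff sin_add cos_add algebra_simps)

lemma plane_rotation_0 [simp]: "plane_rotation i j 0 x = x"
  by (simp add: plane_rotation_def vec_eq_iff)

lemma plane_rotation_swap:
  assumes "i \<noteq> j"
  shows "plane_rotation j i t = plane_rotation i j (- t)"
  using assms by (auto simp: plane_rotation_def vec_eq_iff fun_eq_iff)

text \<open>The outer quarter turn carries axis l to axis m and fixes axis k; the innermost map is
  its inverse.\<close>

lemma plane_rotation_conj:
  assumes "k \<noteq> l" "l \<noteq> m" "k \<noteq> m"
  shows "plane_rotation l m (pi/2) (plane_rotation k l t (plane_rotation m l (pi/2) x))
    = plane_rotation k m t x"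
  using assms by (simp add: plane_rotation_def vec_eq_iff)

lemma orthogonal_transformation_plane_rotation:
  assumes "i \<noteq> j"
  shows "orthogonal_transformation (plane_rotation i j t)"
proof -
  have lin: "linear (plane_rotation i j t)"
    by (rule linearI) (auto simp: plane_rotation_def vec_eq_iff algebra_simps)
  have "plane_rotation i j t x \<bullet> plane_rotation i j t x = x \<bullet> x" for x
  proof -
    have split: "sum f UNIV = f i + f j + sum f (UNIV - {i, j})" for f :: "'a \<Rightarrow> real"
      using assms by (subst sum.subset_diff[of "{i, j}"]) (auto simp: add_ac)
    have "(cos t * x $ i - sin t * x $ j)\<^sup>2 + (sin t * x $ i + cos t * x $ j)\<^sup>2
        = ((sin t)\<^sup>2 + (cos t)\<^sup>2) * ((x $ i)\<^sup>2 + (x $ j)\<^sup>2)"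
      by algebra
    moreover have "(\<Sum>m\<in>UNIV - {i, j}. (plane_rotation i j t x $ m)\<^sup>2)
        = (\<Sum>m\<in>UNIV - {i, j}. (x $ m)\<^sup>2)"
      by (intro sum.cong) (auto simp: plane_rotation_def)
    ultimately show ?thesis
      using assms unfolding inner_vec_def inner_real_def power2_eq_square[symmetric] split
      by (simp add: plane_rotation_def)
  qed
  then show ?thesis
    using lin by (simp add: orthogonal_transformation norm_eq)
qed

text \<open>The vector product with \<open>(1, sqrt 2 - 1, 1)\<close> in the coordinates \<open>(i, j, k)\<close>; this vector spans the
  axis of the rotation by \<open>\<pi> / 4\<close> in the plane \<open>(j, k)\<close> followed by that in the plane \<open>(i, j)\<close>.\<close>

definition twist_axis_cross :: "'n \<Rightarrow> 'n \<Rightarrow> 'n \<Rightarrow> real^'n \<Rightarrow> real^'n::finite" where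
  "twist_axis_cross i j k x =
    axis i ((sqrt 2 - 1) * x $ k - x $ j) + axis j (x $ i - x $ k)
    + axis k (x $ j - (sqrt 2 - 1) * x $ i)"

lemma linear_twist_axis_cross: "linear (twist_axis_cross i j k)"
  by (rule linearI) (auto simp: twist_axis_cross_def vec_eq_iff axis_def algebra_simps)

text \<open>The vector product L with a vector v satisfies L^3 = - |v|^2 L; here |v|^2 = 5 - 2 sqrt
  2.\<close>

lemma twist_axis_cross_cube:
  assumes "i \<noteq> j" "j \<noteq> k" "i \<noteq> k"
  shows "twist_axis_cross i j k (twist_axis_cross i j k (twist_axis_cross i j k x))
    = - (5 - 2 * sqrt 2) *\<^sub>R twist_axis_cross i j k x"
  using assms by (auto simp: twist_axis_cross_def vec_eq_iff axis_def algebra_simps)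

lemma inner_twist_axis_cross:
  "y \<bullet> twist_axis_cross i j k z =
     y $ i * ((sqrt 2 - 1) * z $ k - z $ j) + y $ j * (z $ i - z $ k)
     + y $ k * (z $ j - (sqrt 2 - 1) * z $ i)"
  by (simp add: twist_axis_cross_def inner_add_right inner_axis)

lemma twist_axis_cross_skew:
  "twist_axis_cross i j k x \<bullet> y = - (x \<bullet> twist_axis_cross i j k y)"
  unfolding inner_commute[of "twist_axis_cross i j k x"] inner_twist_axis_cross
  by (simp add: algebra_simps)

lemma plane_rotation_compose_spin:
  assumes "i \<noteq> j" "j \<noteq> k" "i \<noteq> k"
  defines "K \<equiv> \<lambda>x. twist_axis_cross i j k x /\<^sub>R sqrt (5 - 2 * sqrt 2)"
  shows "plane_rotation i j (pi/4) (plane_rotation j k (pi/4) x) = spin K twist_angle x"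
proof -
  interpret L: linear "twist_axis_cross i j k" by (rule linear_twist_axis_cross)
  have pos: "5 - 2 * sqrt 2 > 0" using sqrt2_bounds by simp
  have "spin K twist_angle x = x + ((1 + sqrt 2) / 4) *\<^sub>R twist_axis_cross i j k x
      + ((1 - cos twist_angle) / (5 - 2 * sqrt 2)) *\<^sub>R twist_axis_cross i j k (twist_axis_cross i j k x)"
    using pos by (simp add: spin_def K_def L.scale sin_twist_angle field_simps)
  also have "(1 - cos twist_angle) / (5 - 2 * sqrt 2) = 1 / 4"
    using pos unfolding cos_twist_angle by (simp add: field_simps)
  also have "x + ((1 + sqrt 2) / 4) *\<^sub>R twist_axis_cross i j k x
      + (1 / 4) *\<^sub>R twist_axis_cross i j k (twist_axis_cross i j k x)
      = plane_rotation i j (pi/4) (plane_rotation j k (pi/4) x)"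
    using assms(1-3) by (auto simp: plane_rotation_def twist_axis_cross_def vec_eq_iff axis_def
        cos_45 sin_45 field_simps)
  finally show ?thesis by simp
qed


section \<open>Closed sets invariant under rotations by \<open>\<pi> / 4\<close>\<close>

text \<open>Along the one-parameter orbit of z, the inner product with y is a constant plus
  multiples of sin s and 1 - cos s, with its maximum at s = 0. The derivative there gives the
  equation; comparison with s = pi gives the inequality.\<close>

lemma critical_point_inequalities:
  fixes y z :: "real^'n::finite"
  assumes ijk: "i \<noteq> j" "j \<noteq> k" "i \<noteq> k" and "closed C" and z: "z \<in> C"
    and max: "\<And>w. w \<in> C \<Longrightarrow> y \<bullet> w \<le> y \<bullet> z"
    and inv: "\<And>a b x. a \<noteq> b \<Longrightarrow> x \<in> C \<Longrightarrow> plane_rotation a b (pi/4) x \<in> C"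
  shows "y \<bullet> twist_axis_cross i j k z = 0"
    and "y \<bullet> twist_axis_cross i j k (twist_axis_cross i j k z) \<le> 0"
proof -
  interpret L: linear "twist_axis_cross i j k" by (rule linear_twist_axis_cross)
  have pos: "5 - 2 * sqrt 2 > 0" using sqrt2_bounds by simp
  define K where "K = (\<lambda>x. twist_axis_cross i j k x /\<^sub>R sqrt (5 - 2 * sqrt 2))"
  have linK: "linear K"
    unfolding K_def by (intro linear_compose_scale_right linear_twist_axis_cross)
  have KK: "K (K x) = twist_axis_cross i j k (twist_axis_cross i j k x) /\<^sub>R (5 - 2 * sqrt 2)" for x
    using pos by (simp add: K_def L.scale field_simps flip: real_sqrt_mult)
  have K3: "K (K (K x)) = - K x" for x
  proof -
    have "K (K (K x)) = (inverse (5 - 2 * sqrt 2) * - (5 - 2 * sqrt 2)) *\<^sub>R K x"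
      unfolding KK
      by (simp only: K_def L.scale twist_axis_cross_cube[OF ijk] scaleR_scaleR mult_ac)
    also have "inverse (5 - 2 * sqrt 2) * - (5 - 2 * sqrt 2) = -1"
      using pos by (simp add: field_simps)
    finally show ?thesis by simp
  qed
  have "spin K twist_angle x \<in> C" if "x \<in> C" for x
    using plane_rotation_compose_spin[OF ijk] inv[OF ijk(1) inv[OF ijk(2) that]]
    by (simp add: K_def)
  then have spin: "spin K s z \<in> C" for s
    using spin_invariant_irrational[OF linK K3 twist_angle_irrational \<open>closed C\<close>] z by blast
  define g where "g s = y \<bullet> z + sin s * (y \<bullet> K z) + (1 - cos s) * (y \<bullet> K (K z))" for s
  have g: "g s \<le> g 0" for s
    using max[OF spin[of s]] by (simp add: g_def spin_def inner_add_right)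
  have "(g has_real_derivative y \<bullet> K z) (at 0)"
    unfolding g_def by (auto intro!: derivative_eq_intros)
  then have "y \<bullet> K z = 0"
    by (rule DERIV_local_max[of _ _ _ 1]) (use g in auto)
  then show "y \<bullet> twist_axis_cross i j k z = 0"
    using pos by (simp add: K_def)
  have "y \<bullet> K (K z) \<le> 0"
    using g[of pi] by (simp add: g_def)
  then show "y \<bullet> twist_axis_cross i j k (twist_axis_cross i j k z) \<le> 0"
    using pos unfolding KK by (simp add: mult_le_0_iff)
qed

lemma obtain_third_index:
  fixes i j :: "'n::finite"
  assumes "CARD('n) \<ge> 3"
  obtains k :: 'n where "k \<noteq> i" "k \<noteq> j"
proof -
  have "card {i, j} \<le> 2" by (simp add: card_insert_if)
  then have "{i, j} \<noteq> UNIV" using assms by auto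
  then show thesis using that by blast
qed

text \<open>Maximizing \<open>z \<mapsto> y \<bullet> z\<close> over \<open>C\<close>: criticality along all the one-parameter groups forces
  \<open>z = y\<close> or \<open>z = - y\<close>, and the second-order condition excludes the latter.\<close>

lemma sphere_subset_of_rotation_invariant:
  fixes C :: "(real^'n::finite) set"
  assumes card: "CARD('n) \<ge> 3" and "compact C" "C \<noteq> {}" and sphere: "C \<subseteq> sphere 0 r"
    and inv: "\<And>a b x. a \<noteq> b \<Longrightarrow> x \<in> C \<Longrightarrow> plane_rotation a b (pi/4) x \<in> C"
  shows "sphere 0 r \<subseteq> C"
proof
  fix y :: "real^'n" assume y: "y \<in> sphere 0 r"
  obtain z where z: "z \<in> C" and max: "\<And>w. w \<in> C \<Longrightarrow> y \<bullet> w \<le> y \<bullet> z"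
    using continuous_attains_sup[OF \<open>compact C\<close> \<open>C \<noteq> {}\<close>, of "\<lambda>w. y \<bullet> w"]
      continuous_on_inner[OF continuous_on_const continuous_on_id] by blast
  note crit = critical_point_inequalities[OF _ _ _ compact_imp_closed[OF \<open>compact C\<close>] z max inv]
  have norms: "norm z = norm y" using y z sphere by auto
  have parallel: "y $ i * z $ j = y $ j * z $ i" for i j
  proof (cases "i = j")
    case False
    obtain k where k: "k \<noteq> i" "k \<noteq> j" using obtain_third_index[OF card] by metis
    \<comment> \<open>These are the coordinates of the vector product of y and z in (i, j, k)-space.
      The three cyclic orders of the indices make it orthogonal to three independent axes, so it
      vanishes.\<close>
    define p q s where "p = y $ j * z $ k - y $ k * z $ j"
      and "q = y $ k * z $ i - y $ i * z $ k" and "s = y $ i * z $ j - y $ j * z $ i"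
    have "p + (sqrt 2 - 1) * q + s = 0" "q + (sqrt 2 - 1) * s + p = 0" "s + (sqrt 2 - 1) * p + q = 0"
      using crit(1)[of i j k] crit(1)[of j k i] crit(1)[of k i j] False k
      unfolding inner_twist_axis_cross p_def q_def s_def by (simp_all add: algebra_simps)
    then have "(2 - sqrt 2) * (q - s) = 0" "(2 - sqrt 2) * (p - s) = 0" "p + (sqrt 2 - 1) * q + s = 0"
      by algebra+
    moreover from this have "q = s" "p = s"
      using sqrt2_bounds by auto
    ultimately have "(1 + sqrt 2) * s = 0"
      by (simp add: algebra_simps)
    then show ?thesis
      using sqrt2_bounds by (simp add: s_def)
  qed simp
  have "(y \<bullet> y) *\<^sub>R z = (y \<bullet> z) *\<^sub>R y"
  proof -
    have "(\<Sum>j\<in>UNIV. y $ j * y $ j) * z $ i = (\<Sum>j\<in>UNIV. y $ j * z $ j) * y $ i" for i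
      unfolding sum_distrib_right using parallel[of i] by (intro sum.cong) (auto simp: algebra_simps)
    then show ?thesis by (simp add: vec_eq_iff inner_vec_def)
  qed
  moreover from this have "(y \<bullet> y)\<^sup>2 = (y \<bullet> z)\<^sup>2" if "y \<noteq> 0"
  proof -
    have "norm ((y \<bullet> y) *\<^sub>R z) = norm ((y \<bullet> z) *\<^sub>R y)"
      using calculation by simp
    then have "\<bar>y \<bullet> y\<bar> = \<bar>y \<bullet> z\<bar>" using that by (simp add: norms)
    then show ?thesis by (simp add: power2_eq_iff abs_eq_iff)
  qed
  ultimately consider "y = 0" | "y \<noteq> 0" "z = y" | "y \<noteq> 0" "z = - y"
    by (smt (verit) inner_eq_zero_iff power2_eq_iff scaleR_cancel_left scaleR_minus_left scaleR_minus_right)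
  then show "y \<in> C"
  proof cases
    case 1
    then show ?thesis using z norms by simp
  next
    case 2
    then show ?thesis using z by simp
  next
    case 3
    \<comment> \<open>As L is skew and y = - z, the inner product of y with L (L z) is |L z|^2,
      which the second-order condition bounds by 0.\<close>
    have Lz: "twist_axis_cross i j k z = 0" if "i \<noteq> j" "j \<noteq> k" "i \<noteq> k" for i j k
    proof -
      have "y \<bullet> twist_axis_cross i j k w = twist_axis_cross i j k z \<bullet> w" for w
        using 3 by (simp add: twist_axis_cross_skew)
      then have "twist_axis_cross i j k z \<bullet> twist_axis_cross i j k z \<le> 0"
        using crit(2)[OF that] by simp
      then show ?thesis by (metis inner_ge_zero inner_eq_zero_iff order_antisym)
    qed
    have "z $ i = 0" for i
    proof -
      obtain j where j: "j \<noteq> i" using obtain_third_index[OF card] by metis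
      obtain k where k: "k \<noteq> i" "k \<noteq> j" using obtain_third_index[OF card] by metis
      \<comment> \<open>The (i, j, k)-part of z is parallel to the twist axis, and also to the
        different axis obtained by exchanging i and j.\<close>
      have "twist_axis_cross i j k z $ j = 0" "twist_axis_cross j i k z $ i = 0"
        "twist_axis_cross i j k z $ k = 0"
        using Lz[of i j k] Lz[of j i k] j k by auto
      then have "z $ i = z $ k" "z $ j = z $ k" "z $ j = (sqrt 2 - 1) * z $ i"
        using j k by (simp_all add: twist_axis_cross_def axis_def)
      then have "(2 - sqrt 2) * z $ i = 0" by (simp add: algebra_simps)
      then show ?thesis using sqrt2_bounds by simp
    qed
    then have "z = 0" by (simp add: vec_eq_iff)
    then show ?thesis using 3 by simp
  qed
qed

lemma rotation_invariant_open_sphere: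
  fixes S :: "(real^'n::finite) set"
  assumes card: "CARD('n) \<ge> 3" and "open S"
    and inv: "\<And>a b. a \<noteq> b \<Longrightarrow> plane_rotation a b (pi/4) ` S = S"
    and x: "x \<in> S" and y: "norm y = norm x"
  shows "y \<in> S"
proof -
  \<comment> \<open>With all linear isometries preserving S in G, composing with a rotation stays in
    G; continuity carries the invariance of the orbit over to its closure.\<close>
  define G where "G = {g :: real^'n \<Rightarrow> real^'n. orthogonal_transformation g \<and> g ` S = S}"
  define C where "C = closure ((\<lambda>g. g x) ` G)"
  have "(\<lambda>v. v) \<in> G" by (simp add: G_def)
  then have "C \<noteq> {}" by (auto simp: C_def)
  have sub: "C \<subseteq> sphere 0 (norm x)"
    unfolding C_def
    by (rule closure_minimal) (auto simp: G_def orthogonal_transformation_norm)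
  have "compact C"
    unfolding C_def compact_closure
    by (rule bounded_subset[OF bounded_sphere[of 0 "norm x"]])
      (auto simp: G_def orthogonal_transformation_norm)
  have "plane_rotation a b (pi/4) w \<in> C" if ab: "a \<noteq> b" and w: "w \<in> C" for a b w
  proof -
    let ?R = "plane_rotation a b (pi/4)"
    have R: "orthogonal_transformation ?R"
      by (rule orthogonal_transformation_plane_rotation[OF ab])
    have "?R \<circ> g \<in> G" if "g \<in> G" for g
      using that R inv[OF ab] by (auto simp only: G_def mem_Collect_eq orthogonal_transformation_compose image_comp[symmetric])
    then have "?R ` (\<lambda>g. g x) ` G \<subseteq> (\<lambda>g. g x) ` G"
      unfolding image_image by (metis (no_types, lifting) comp_apply image_eqI image_subsetI)
    then have "closure (?R ` (\<lambda>g. g x) ` G) \<subseteq> C"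
      unfolding C_def by (rule closure_mono)
    then show ?thesis
      using closure_linear_image_subset[OF orthogonal_transformation_linear[OF R]] w
      unfolding C_def by blast
  qed
  then have "y \<in> C"
    using sphere_subset_of_rotation_invariant[OF card \<open>compact C\<close> \<open>C \<noteq> {}\<close> sub] y by auto
  obtain e where "e > 0" and e: "ball x e \<subseteq> S"
    using \<open>open S\<close> x open_contains_ball by blast
  obtain g where g: "orthogonal_transformation g" "g ` S = S" "dist (g x) y < e"
    using \<open>y \<in> C\<close> \<open>e > 0\<close> unfolding C_def closure_approachable G_def by auto
  \<comment> \<open>Since g is an isometry, the preimage u of y is as close to x as y is to g x. So
    u lies in S, and so does its image y.\<close>
  obtain u where u: "y = g u"
    using orthogonal_transformation_surj[OF g(1)] by (metis surjD)
  then have "u \<in> ball x e"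
    using g unfolding orthogonal_transformation_isometry by simp
  then show ?thesis using u e g(2) by blast
qed

section \<open>Domains\<close>

text \<open>Subtracting \<open>T 0\<close> leaves an orthogonal, hence surjective linear,
  map.\<close>

lemma open_isometry_image:
  fixes T :: "'a::euclidean_space \<Rightarrow> 'a"
  assumes "is_isometry T" "open \<Omega>"
  shows "open (T ` \<Omega>)"
proof -
  define f where "f x = T x - T 0" for x
  have f: "orthogonal_transformation f"
    using assms(1) by (simp add: orthogonal_transformation_isometry f_def is_isometry_def dist_norm)
  have "open (f ` \<Omega>)"
    using f assms(2)
    by (intro open_surjective_linear_image orthogonal_transformation_surj orthogonal_transformation_linear)
  moreover have "T ` \<Omega> = (+) (T 0) ` f ` \<Omega>"
    by (auto simp: f_def image_image)
  ultimately show ?thesis by (simp add: open_translation)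
qed

lemma plane_rotation_image_swap:
  assumes "i \<noteq> j" "plane_rotation i j t ` S = S"
  shows "plane_rotation j i t ` S = S"
proof -
  have "plane_rotation j i t ` plane_rotation i j t ` S = S"
    using assms(1) by (simp add: plane_rotation_swap[OF assms(1)] image_image plane_rotation_add)
  then show ?thesis by (simp only: assms(2))
qed

lemma plane_rotation_image_conj:
  assumes "k \<noteq> l" "l \<noteq> m" "k \<noteq> m"
    and "plane_rotation l m (pi/2) ` S = S" "plane_rotation k l t ` S = S"
  shows "plane_rotation k m t ` S = S"
proof -
  have "plane_rotation m l (pi/2) ` S = S"
    using plane_rotation_image_swap assms by blast
  moreover have "plane_rotation k m t ` S
      = plane_rotation l m (pi/2) ` plane_rotation k l t ` plane_rotation m l (pi/2) ` S"
    by (simp add: image_image plane_rotation_conj[OF assms(1-3)])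
  ultimately show ?thesis using assms by simp
qed

lemma plane_rotation_image_double:
  assumes "i \<noteq> j" "plane_rotation i j t ` S = S"
  shows "plane_rotation i j (2 * t) ` S = S"
proof -
  have "plane_rotation i j (2 * t) ` S = plane_rotation i j t ` plane_rotation i j t ` S"
    by (simp add: image_image plane_rotation_add[OF assms(1)])
  then show ?thesis using assms by simp
qed

lemma C_8_4_rotations:
  assumes "k < l" and kl: "plane_rotation k l (2 * pi / 8) ` S = S"
    and ij: "\<forall>i j. i < j \<and> (i, j) \<noteq> (k, l) \<longrightarrow> plane_rotation i j (2 * pi / 4) ` S = S"
    and "a \<noteq> (b :: 'n::{finite,linorder})"
  shows "plane_rotation a b (pi/4) ` S = S"
proof -
  have "k \<noteq> l" using assms by simp
  have kl: "plane_rotation k l (pi/4) ` S = S"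
    using kl by (simp add: field_simps)
  \<comment> \<open>The hypothesis on quarter turns exempts the plane (k, l); there the quarter turn
    is the square of the eighth turn.\<close>
  have quarter_less: "plane_rotation i j (pi/2) ` S = S" if "i < j" for i j
    using plane_rotation_image_double[OF \<open>k \<noteq> l\<close> kl] ij[rule_format, of i j] that
    by (cases "(i, j) = (k, l)") (auto simp: field_simps)
  have quarter: "plane_rotation i j (pi/2) ` S = S" if "i \<noteq> j" for i j
    using quarter_less plane_rotation_image_swap that by (metis neqE)
  have step: "plane_rotation i m (pi/4) ` S = S"
    if "plane_rotation i j (pi/4) ` S = S" "i \<noteq> j" "i \<noteq> m" for i j m
    using plane_rotation_image_conj[of i j m S "pi/4"] quarter[of j m] that by metis
  show ?thesis
    \<comment> \<open>Replacing one index at a time, with swaps to reach the first one, leads from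
      (k, l) to every pair.\<close>
    using kl step plane_rotation_image_swap \<open>k \<noteq> l\<close> \<open>a \<noteq> b\<close> by metis
qed

theorem mainTheorem5:
  assumes "CARD('n::{finite,linorder}) \<ge> 3"
  shows "(C_8_4 :: (real^'n::{finite,linorder}) set set) = symmetric_domains 8 \<and>
    (\<forall>\<Omega> \<in> (C_8_4 :: (real^'n::{finite,linorder}) set set). radially_symmetric \<Omega>)"
proof (intro conjI ballI equalityI subsetI)
  \<comment> \<open>This block settles two goals, order 8 symmetry and radial symmetry, with the
    same isometry T.\<close>
  fix \<Omega> :: "(real, 'n) vec set" assume "\<Omega> \<in> C_8_4"
  then obtain T k l where dom: "is_domain \<Omega>" and T: "is_isometry T" and kl: "k < l"
    "plane_rotation k l (2 * pi / 8) ` T ` \<Omega> = T ` \<Omega>"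
    "\<forall>i j. i < j \<and> (i, j) \<noteq> (k, l) \<longrightarrow> plane_rotation i j (2 * pi / 4) ` T ` \<Omega> = T ` \<Omega>"
    unfolding C_8_4_def mem_Collect_eq by (elim conjE exE) (rule that)
  have rot: "plane_rotation a b (pi/4) ` T ` \<Omega> = T ` \<Omega>" if "a \<noteq> b" for a b
    by (rule C_8_4_rotations[OF kl that])
  have "plane_rotation a b (2 * pi / real 8) ` T ` \<Omega> = T ` \<Omega>" if "a < b" for a b
    using rot[of a b] that by simp
  then show "\<Omega> \<in> symmetric_domains 8"
    unfolding symmetric_domains_def mem_Collect_eq using dom T by blast
  have open_T: "open (T ` \<Omega>)"
    using open_isometry_image T dom by (auto simp: is_domain_def)
  note sphere = rotation_invariant_open_sphere[OF assms open_T rot]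
  have "(*v) A ` T ` \<Omega> = T ` \<Omega>" if "rotation_matrix A" for A :: "((real, 'n) vec, 'n) vec"
  proof -
    have A: "orthogonal_transformation ((*v) A)"
      using that by (simp add: rotation_matrix_def orthogonal_transformation_matrix)
    note norm = orthogonal_transformation_norm[OF A]
    show ?thesis
    proof (intro equalityI subsetI)
      fix v assume "v \<in> (*v) A ` T ` \<Omega>"
      then show "v \<in> T ` \<Omega>" using sphere norm by blast
    next
      fix v assume v: "v \<in> T ` \<Omega>"
      obtain u where "v = A *v u"
        using orthogonal_transformation_surj[OF A] by (metis surjD)
      then show "v \<in> (*v) A ` T ` \<Omega>" using sphere[OF _ v, of u] norm by auto
    qed
  qed
  then show "radially_symmetric \<Omega>"
    unfolding radially_symmetric_def using dom T by blast
next
  fix \<Omega> :: "(real, 'n) vec set" assume "\<Omega> \<in> symmetric_domains 8"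
  then obtain T where dom: "is_domain \<Omega>" and T: "is_isometry T"
    and rot: "\<And>i j. i < j \<Longrightarrow> plane_rotation i j (2 * pi / 8) ` T ` \<Omega> = T ` \<Omega>"
    unfolding symmetric_domains_def by auto
  obtain k l :: 'n where "k < l"
    using obtain_third_index[OF assms] by (metis neqE)
  have "plane_rotation i j (2 * pi / 4) ` T ` \<Omega> = T ` \<Omega>" if "i < j" for i j
    using plane_rotation_image_double[OF _ rot[OF that]] that by simp
  then show "\<Omega> \<in> C_8_4"
    unfolding C_8_4_def using dom T rot \<open>k < l\<close> by blast
qed

end
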